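(* Let $(X,d)$ be a compact metric space, let $f_n:X\to X$ be continuous for every $n\ge0$, let $A=(a_{ij})_{N\times N}$ be a transition matrix, let $V_i$, $1\le i\le N$, be disjoint nonempty closed subsets of $X$, and let $\{V_{i,n}\}_{n=0}^\infty$, $1\le i\le N$, be sequences of nonempty compact subsets of $X$ with $V_{i,n}\subset V_i$ for all $1\le i\le N$, $n\ge0$. Assume that the system $x_{n+1}=f_n(x_n)$ is weakly $A$-coupled-expanding in $\{V_{i,n}\}_{n=0}^\infty$, $1\le i\le N$. Then $h(\bar f_{0,\infty})\ge\log\rho(A)$.
   Context: $\mathcal K(X)$ is the set of all nonempty compact subsets of $X$ with the Hausdorff metric $\mathcal H_d(B,C):=\max\{\sup_{b\in B}d(b,C),\sup_{c\in C}d(c,B)\}$ (a compact metric space); $\bar f_n:\mathcal K(X)\to\mathcal K(X)$ is $\bar f_n(B):=f_n(B)$; $\bar f_{0,\infty}:=\{\bar f_n\}_{n=0}^\infty$. A transition matrix is a matrix $A=(a_{ij})_{N\times N}$, $N\ge2$, with $a_{ij}\in\{0,1\}$, $\sum_{j=1}^N a_{ij}\ge1$ for all $i$ and $\sum_{i=1}^N a_{ij}\ge1$ for all $j$. $\rho(A):=\lim_{n\to\infty}\|A^n\|^{1/n}$, where $\|B\|$ denotes the sum of all entries of $B$. The system $x_{n+1}=f_n(x_n)$ is weakly $A$-coupled-expanding in $\{V_{i,n}\}_{n=0}^\infty$, $1\le i\le N$, if $V_{i,n}\cap V_{j,n}=\partial V_{i,n}\cap\partial V_{j,n}$ for all $1\le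 i\ne j\le N$, $n\ge0$, and $f_n(V_{i,n})\supset\bigcup_{j:\,a_{ij}=1}V_{j,n+1}$ for all $1\le i\le N$, $n\ge0$. Topological entropy: for a compact metric space $Z$ and maps $g_n:Z\to Z$, $n\ge0$, put $g_0^n:=g_{n-1}\circ\cdots\circ g_0$ for $n\ge1$, $g_0^0$ the identity, $g_0^{-n}:=(g_0^n)^{-1}$ (preimage). Then $h(g_{0,\infty}):=\sup_{\mathcal A}\limsup_{n\to\infty}\frac1n\log\mathcal N(\mathcal A_0^n)$, the supremum over open covers $\mathcal A$ of $Z$, where $\mathcal A_0^n:=\{\bigcap_{j=0}^{n-1}g_0^{-j}(A_j):A_j\in\mathcal A\}$ and $\mathcal N(\cdot)$ is the minimal cardinality of a subcover. *)

theory Defs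
  imports "Jordan_Normal_Form.Matrix" "HOL-Analysis.Analysis"
begin

section \<open>The hyperspace of nonempty compact subsets\<close>

definition mdist_set :: "'a metric \<Rightarrow> 'a \<Rightarrow> 'a set \<Rightarrow> real" where
  "mdist_set X b C = (INF c\<in>C. mdist X b c)"

definition hausdorff_mdist :: "'a metric \<Rightarrow> 'a set \<Rightarrow> 'a set \<Rightarrow> real" where
  "hausdorff_mdist X B C = max (SUP b\<in>B. mdist_set X b C) (SUP c\<in>C. mdist_set X c B)"

definition nonempty_compacts :: "'a metric \<Rightarrow> 'a set set" where
  "nonempty_compacts X = {B. B \<noteq> {} \<and> compactin (mtopology_of X) B}"

text \<open>\<^locale>\<open>Metric_space\<close> demands nonnegativity of the distance on the whole type, whereas
  the supremum of an unbounded set of reals is unspecified; hence the value \<open>0\<close> off the carrier.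
  That this is a metric is verified below in \<open>Metric_space_hausdorff\<close>.\<close>

definition hyperspace :: "'a metric \<Rightarrow> 'a set metric" where
  "hyperspace X = metric (nonempty_compacts X,
     \<lambda>B C. if B \<in> nonempty_compacts X \<and> C \<in> nonempty_compacts X then hausdorff_mdist X B C else 0)"

lemma mdist_set_nonneg: "C \<noteq> {} \<Longrightarrow> 0 \<le> mdist_set X b C"
  unfolding mdist_set_def by (rule cINF_greatest) auto

lemma mdist_set_le: "c \<in> C \<Longrightarrow> mdist_set X b C \<le> mdist X b c"
  unfolding mdist_set_def by (rule cINF_lower) (auto intro!: bdd_belowI2[where m = 0])

lemma nonempty_compactsD:
  assumes "B \<in> nonempty_compacts X"
  shows "B \<noteq> {}" "B \<subseteq> mspace X" "compactin (mtopology_of X) B" "closedin (mtopology_of X) B"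
    "\<And>x. x \<in> mspace X \<Longrightarrow> \<exists>r. \<forall>b\<in>B. mdist X x b \<le> r"
proof -
  interpret Metric_space "mspace X" "mdist X" by (rule Metric_space_mspace_mdist)
  have top: "mtopology_of X = mtopology" by (simp add: mtopology_of_def)
  show ne: "B \<noteq> {}" and c: "compactin (mtopology_of X) B"
    using assms by (auto simp: nonempty_compacts_def)
  show sub: "B \<subseteq> mspace X" using compactin_subset_topspace[OF c] by simp
  show "closedin (mtopology_of X) B"
    using c compactin_imp_closedin Hausdorff_space_mtopology by (simp add: top)
  have "mbounded B" using c compactin_imp_mbounded by (simp add: top)
  then obtain y r where y: "y \<in> mspace X" "\<forall>b\<in>B. mdist X y b \<le> r"
    using ne unfolding mbounded by blast
  show "\<exists>r. \<forall>b\<in>B. mdist X x b \<le> r" if x: "x \<in> mspace X" for x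
  proof (intro exI ballI)
    fix b assume "b \<in> B"
    then show "mdist X x b \<le> mdist X x y + r"
      using y x sub mdist_triangle[of x X y b] by force
  qed
qed

lemma mdist_set_le_hausdorff:
  assumes "B \<in> nonempty_compacts X" "C \<in> nonempty_compacts X" "b \<in> B"
  shows "mdist_set X b C \<le> hausdorff_mdist X B C"
proof -
  note B = nonempty_compactsD[OF assms(1)] and C = nonempty_compactsD[OF assms(2)]
  obtain c where c: "c \<in> C" "c \<in> mspace X" using C by blast
  obtain r where r: "\<forall>b\<in>B. mdist X c b \<le> r" using B(5) c by blast
  have "bdd_above ((\<lambda>b. mdist_set X b C) ` B)"
  proof (rule bdd_aboveI2)
    fix b assume "b \<in> B"
    then show "mdist_set X b C \<le> r"
      using mdist_set_le[OF c(1), of X b] r by (metis mdist_commute order_trans)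
  qed
  then have "mdist_set X b C \<le> (SUP b\<in>B. mdist_set X b C)"
    by (rule cSUP_upper[OF assms(3)])
  then show ?thesis by (simp add: hausdorff_mdist_def)
qed

lemma hausdorff_mdist_commute: "hausdorff_mdist X B C = hausdorff_mdist X C B"
  by (simp add: hausdorff_mdist_def max.commute)

lemma hausdorff_mdist_le:
  assumes "B \<noteq> {}" "C \<noteq> {}"
    and "\<And>b. b \<in> B \<Longrightarrow> mdist_set X b C \<le> r" "\<And>c. c \<in> C \<Longrightarrow> mdist_set X c B \<le> r"
  shows "hausdorff_mdist X B C \<le> r"
  unfolding hausdorff_mdist_def using assms by (auto intro!: cSUP_least)

lemma mdist_set_triangle:
  assumes B: "B \<in> nonempty_compacts X" and C: "C \<in> nonempty_compacts X"
    and D: "D \<in> nonempty_compacts X" and b: "b \<in> B"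
  shows "mdist_set X b D \<le> hausdorff_mdist X B C + hausdorff_mdist X C D"
proof -
  note mB = nonempty_compactsD[OF B] and mC = nonempty_compactsD[OF C]
    and mD = nonempty_compactsD[OF D]
  have 1: "mdist_set X b D \<le> mdist X b c + hausdorff_mdist X C D" if c: "c \<in> C" for c
  proof -
    have "mdist_set X b D - mdist X b c \<le> mdist X c e" if e: "e \<in> D" for e
      using mdist_set_le[OF e, of X b] mdist_triangle[of b X c e] mB mC mD b c e by force
    then have "mdist_set X b D - mdist X b c \<le> mdist_set X c D"
      unfolding mdist_set_def[of X c] using mD(1) by (intro cINF_greatest) auto
    then show ?thesis using mdist_set_le_hausdorff[OF C D c] by simp
  qed
  have "mdist_set X b D - hausdorff_mdist X C D \<le> mdist_set X b C"
    unfolding mdist_set_def[of X b C] using mC(1) 1 by (intro cINF_greatest) (auto simp: algebra_simps)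
  then show ?thesis using mdist_set_le_hausdorff[OF B C b] by simp
qed

lemma mdist_set_eq_0:
  assumes "x \<in> mspace X" "C \<in> nonempty_compacts X" "mdist_set X x C \<le> 0"
  shows "x \<in> C"
proof -
  interpret Metric_space "mspace X" "mdist X" by (rule Metric_space_mspace_mdist)
  note C = nonempty_compactsD[OF assms(2)]
  have "\<exists>c\<in>C. mdist X x c < r" if "r > 0" for r
  proof (rule ccontr)
    assume "\<not> (\<exists>c\<in>C. mdist X x c < r)"
    then have "r \<le> mdist_set X x C"
      unfolding mdist_set_def using C(1) by (intro cINF_greatest) (auto simp: not_less)
    then show False using that assms(3) by simp
  qed
  then have "x \<in> mtopology closure_of C"
    using assms(1) C(2) unfolding metric_closure_of by (auto simp: subset_iff)
  then show ?thesis
    using C(4) by (simp add: closure_of_closedin mtopology_of_def)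
qed

lemma Metric_space_hausdorff: "Metric_space (nonempty_compacts X)
   (\<lambda>B C. if B \<in> nonempty_compacts X \<and> C \<in> nonempty_compacts X then hausdorff_mdist X B C else 0)"
  (is "Metric_space ?K ?d")
proof
  have nn: "0 \<le> hausdorff_mdist X B C"
    if BC: "B \<in> nonempty_compacts X" "C \<in> nonempty_compacts X" for B C
  proof -
    obtain b where "b \<in> B" using nonempty_compactsD(1)[OF BC(1)] by blast
    then show ?thesis
      using mdist_set_le_hausdorff[OF BC] mdist_set_nonneg[OF nonempty_compactsD(1)[OF BC(2)]]
      by (meson order_trans)
  qed
  have z: "hausdorff_mdist X B C = 0 \<longleftrightarrow> B = C"
    if BC: "B \<in> nonempty_compacts X" "C \<in> nonempty_compacts X" for B C
  proof
    assume 0: "hausdorff_mdist X B C = 0"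
    have "B \<subseteq> C"
    proof
      fix b assume b: "b \<in> B"
      have "mdist_set X b C \<le> 0" using mdist_set_le_hausdorff[OF BC b] 0 by simp
      moreover have "b \<in> mspace X" using b nonempty_compactsD(2)[OF BC(1)] by (rule subsetD[rotated])
      ultimately show "b \<in> C" using mdist_set_eq_0[OF _ BC(2)] by simp
    qed
    moreover have "C \<subseteq> B"
    proof
      fix c assume c: "c \<in> C"
      have "mdist_set X c B \<le> 0"
        using mdist_set_le_hausdorff[OF BC(2,1) c] 0 hausdorff_mdist_commute[of X B C] by linarith
      moreover have "c \<in> mspace X" using c nonempty_compactsD(2)[OF BC(2)] by (rule subsetD[rotated])
      ultimately show "c \<in> B" using mdist_set_eq_0[OF _ BC(1)] by simp
    qed
    ultimately show "B = C" by (rule equalityI)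
  next
    assume "B = C"
    have "mdist_set X b B \<le> 0" if "b \<in> B" for b
    proof -
      have "b \<in> mspace X" using that nonempty_compactsD(2)[OF BC(1)] by blast
      then have "mdist X b b = 0" by (simp add: Abstract_Metric_Spaces.mdist_zero)
      then show ?thesis using mdist_set_le[OF that, of X b] by linarith
    qed
    then have "hausdorff_mdist X B B \<le> 0"
      by (intro hausdorff_mdist_le nonempty_compactsD(1)[OF BC(1)])
    then show "hausdorff_mdist X B C = 0" using nn[OF BC(1,1)] \<open>B = C\<close> by simp
  qed
  have tri: "hausdorff_mdist X B D \<le> hausdorff_mdist X B C + hausdorff_mdist X C D"
    if B: "B \<in> nonempty_compacts X" and C: "C \<in> nonempty_compacts X"
      and D: "D \<in> nonempty_compacts X" for B C D
  proof (rule hausdorff_mdist_le)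
    show "B \<noteq> {}" "D \<noteq> {}" by (rule nonempty_compactsD(1)[OF B], rule nonempty_compactsD(1)[OF D])
    show "mdist_set X b D \<le> hausdorff_mdist X B C + hausdorff_mdist X C D" if "b \<in> B" for b
      by (rule mdist_set_triangle[OF B C D that])
    show "mdist_set X e B \<le> hausdorff_mdist X B C + hausdorff_mdist X C D" if "e \<in> D" for e
      using mdist_set_triangle[OF D C B that] hausdorff_mdist_commute[of X D C]
        hausdorff_mdist_commute[of X C B] by linarith
  qed
  show "0 \<le> ?d B C" for B C using nn[of B C] by simp
  show "?d B C = ?d C B" for B C using hausdorff_mdist_commute[of X B C] by simp
  show "?d B C = 0 \<longleftrightarrow> B = C" if "B \<in> ?K" "C \<in> ?K" for B C
    using that z[of B C] by simp
  show "?d B D \<le> ?d B C + ?d C D" if "B \<in> ?K" "C \<in> ?K" "D \<in> ?K" for B C D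
    using that tri[of B C D] by simp
qed

lemma mspace_hyperspace [simp]: "mspace (hyperspace X) = nonempty_compacts X"
  unfolding hyperspace_def by (rule Metric_space.mspace_metric[OF Metric_space_hausdorff])

lemma mdist_hyperspace:
  "B \<in> nonempty_compacts X \<Longrightarrow> C \<in> nonempty_compacts X \<Longrightarrow>
    mdist (hyperspace X) B C = hausdorff_mdist X B C"
  unfolding hyperspace_def Metric_space.mdist_metric[OF Metric_space_hausdorff] by simp

section \<open>Topological entropy of a nonautonomous system\<close>

fun iter_seq :: "(nat \<Rightarrow> 'z \<Rightarrow> 'z) \<Rightarrow> nat \<Rightarrow> 'z \<Rightarrow> 'z" where
  "iter_seq g 0 = id"
| "iter_seq g (Suc n) = g n \<circ> iter_seq g n"

definition open_cover :: "'z topology \<Rightarrow> 'z set set \<Rightarrow> bool" where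
  "open_cover T \<A> \<longleftrightarrow> (\<forall>U\<in>\<A>. openin T U) \<and> \<Union>\<A> = topspace T"

definition cover_join ::
  "'z topology \<Rightarrow> (nat \<Rightarrow> 'z \<Rightarrow> 'z) \<Rightarrow> 'z set set \<Rightarrow> nat \<Rightarrow> 'z set set" where
  "cover_join T g \<A> n =
     {topspace T \<inter> (\<Inter>j<n. iter_seq g j -` U j) | U. \<forall>j<n. U j \<in> \<A>}"

text \<open>Meaningful for covers with a finite subcover, e.g. open covers of a compact space.\<close>

definition min_subcover_card :: "'z topology \<Rightarrow> 'z set set \<Rightarrow> nat" where
  "min_subcover_card T \<C> =
     (LEAST k. \<exists>\<D>\<subseteq>\<C>. finite \<D> \<and> \<Union>\<D> = topspace T \<and> card \<D> = k)"

definition topological_entropy :: "'z topology \<Rightarrow> (nat \<Rightarrow> 'z \<Rightarrow> 'z) \<Rightarrow> ereal" where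
  "topological_entropy T g =
     (SUP \<A> \<in> {\<A>. open_cover T \<A>}.
        limsup (\<lambda>n. ereal (ln (real (min_subcover_card T (cover_join T g \<A> n))) / real n)))"

section \<open>Transition matrices and coupled expansion\<close>

text \<open>Indices run over \<open>0, \<dots>, N - 1\<close>, as usual for the type \<^typ>\<open>real mat\<close>.\<close>

definition transition_matrix :: "nat \<Rightarrow> real mat \<Rightarrow> bool" where
  "transition_matrix N A \<longleftrightarrow>
     N \<ge> 2 \<and> A \<in> carrier_mat N N \<and>
     (\<forall>i<N. \<forall>j<N. A $$ (i, j) \<in> {0, 1}) \<and>
     (\<forall>i<N. (\<Sum>j<N. A $$ (i, j)) \<ge> 1) \<and>
     (\<forall>j<N. (\<Sum>i<N. A $$ (i, j)) \<ge> 1)"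

text \<open>The limit \<open>\<rho>(A)\<close> exists since \<^const>\<open>sum_mat\<close> is submultiplicative on nonnegative matrices.\<close>

definition growth_rate :: "real mat \<Rightarrow> real" where
  "growth_rate A = lim (\<lambda>n. root n (sum_mat (A ^\<^sub>m n)))"

definition weakly_coupled_expanding ::
  "'a topology \<Rightarrow> nat \<Rightarrow> real mat \<Rightarrow> (nat \<Rightarrow> 'a \<Rightarrow> 'a) \<Rightarrow> (nat \<Rightarrow> nat \<Rightarrow> 'a set) \<Rightarrow> bool" where
  "weakly_coupled_expanding T N A f V \<longleftrightarrow>
     (\<forall>n. \<forall>i<N. \<forall>j<N. i \<noteq> j \<longrightarrow>
        V i n \<inter> V j n = T frontier_of (V i n) \<inter> T frontier_of (V j n)) \<and>
     (\<forall>n. \<forall>i<N. (\<Union>j\<in>{j. j < N \<and> A $$ (i, j) = 1}. V j (Suc n)) \<subseteq> f n ` V i n)"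

end

theory Submission
  imports Defs
begin

text \<open>
  Pulling back points along the inclusions \<open>f\<^sub>n(V\<^sub>i\<^sub>,\<^sub>n) \<supseteq> V\<^sub>j\<^sub>,\<^sub>n\<^sub>+\<^sub>1\<close> produces, for every \<open>n\<close>,
  a set of \<open>\<parallel>A\<^sup>n\<parallel>\<close> points of \<open>X\<close>, any two of which lie in distinct sets \<open>W\<^sub>a\<close>, \<open>W\<^sub>b\<close> at some
  time \<open>k \<le> n\<close>. The hyperspace is covered by the \<open>N\<close> open sets of those compacta that are not
  contained in \<open>\<Union>\<^sub>j\<^sub>\<noteq>\<^sub>i W\<^sub>j\<close>, and a singleton from \<open>W\<^sub>a\<close> belongs only to the one with index
  \<open>a\<close>. Hence the singletons of these points lie in distinct members of the join of length
  \<open>n + 1\<close>, every subcover of which thus has at least \<open>\<parallel>A\<^sup>n\<parallel>\<close> members.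
\<close>

section \<open>The growth rate of a transition matrix\<close>

text \<open>Nonnegativity makes the infimum a finite number, and the quotients never drop below it.
  For the other bound, fix \<open>m\<close> with \<open>a m / m\<close> close to the infimum and
  write \<open>n = q * m + r\<close> with \<open>r < m\<close>: subadditivity gives
  \<open>q * a m\<close> plus a remainder that is bounded in \<open>n\<close>.\<close>

lemma fekete:
  fixes a :: "nat \<Rightarrow> real"
  assumes nonneg: "\<And>n. 0 \<le> a n" and subadd: "\<And>m n. a (m + n) \<le> a m + a n"
  shows "(\<lambda>n. a n / n) \<longlonglongrightarrow> (INF n\<in>{1..}. a n / n)" (is "_ \<longlonglongrightarrow> ?L")
proof (rule order_tendstoI)
  have bdd: "bdd_below ((\<lambda>n. a n / n) ` {1..})"
    by (rule bdd_belowI2[where m = 0]) (simp add: nonneg)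
  show "\<forall>\<^sub>F n in sequentially. c < a n / n" if c: "c < ?L" for c
    using eventually_ge_at_top[of 1]
  proof eventually_elim
    case (elim n)
    then have "?L \<le> a n / n" using bdd by (intro cINF_lower) auto
    then show ?case using c by simp
  qed
  show "\<forall>\<^sub>F n in sequentially. a n / n < c" if c: "?L < c" for c
  proof -
    obtain m :: nat where m: "m \<ge> 1" "a m / m < c"
      using c cINF_less_iff[OF _ bdd] by auto
    \<comment> \<open>A bound for \<open>a r\<close> that is uniform over all remainders
      \<open>r < m\<close>; its contribution \<open>C / n\<close> tends to 0.\<close>
    define C where "C = (\<Sum>r<m. a r)"
    have mult: "a (q * m + r) \<le> q * a m + a r" for q r
    proof (induction q)
      case (Suc q)
      have "a (Suc q * m + r) \<le> a m + a (q * m + r)"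
        using subadd[of m "q * m + r"] by (simp add: algebra_simps)
      then show ?case using Suc by (simp add: algebra_simps)
    qed simp
    have upper: "a n / n \<le> a m / m + C / n" if n: "n \<ge> 1" for n
    proof -
      have "a (n mod m) \<le> C"
        unfolding C_def using m by (intro member_le_sum) (auto simp: nonneg)
      then have "a n \<le> (n div m) * a m + C"
        using mult[of "n div m" "n mod m"] by simp
      also have "(n div m) * a m \<le> n / m * a m"
        by (intro mult_right_mono nonneg) (simp add: of_nat_div_le_of_nat)
      finally have "a n \<le> n * (a m / m) + C" by simp
      then show ?thesis using n by (simp add: field_simps)
    qed
    have "(\<lambda>n. a m / m + C / real n) \<longlonglongrightarrow> a m / m + 0"
      by (intro tendsto_intros lim_const_over_n)
    then have "\<forall>\<^sub>F n in sequentially. a m / m + C / real n < c"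
      by (rule order_tendstoD) (use m in simp)
    then show ?thesis
      using eventually_ge_at_top[of 1] by eventually_elim (use upper in fastforce)
  qed
qed

section \<open>Entry sums of matrix products\<close>

lemma mult_mat_entry:
  assumes "A \<in> carrier_mat N N" "B \<in> carrier_mat N N" "i < N" "j < N"
  shows "(A * B) $$ (i, j) = (\<Sum>k<N. A $$ (i, k) * B $$ (k, j))"
  using assms by (simp add: scalar_prod_def lessThan_atLeast0)

lemma sum_mat_rows: "A \<in> carrier_mat N N \<Longrightarrow> sum_mat A = (\<Sum>i<N. \<Sum>j<N. A $$ (i, j))"
  by (simp add: sum_mat_def sum.cartesian_product lessThan_atLeast0 prod.case_distrib)

lemma pow_mat_add:
  fixes A :: "'a :: semiring_1 mat"
  assumes A: "A \<in> carrier_mat N N"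
  shows "A ^\<^sub>m (m + n) = A ^\<^sub>m m * A ^\<^sub>m n"
proof (induction n)
  case (Suc n)
  then show ?case
    using assoc_mult_mat[of "A ^\<^sub>m m" N N "A ^\<^sub>m n" N A N] A by simp
qed (use A in auto)

text \<open>The right-hand side pairs every entry of \<open>A\<close> with every entry of
  \<open>B\<close>. The product matrix keeps only the pairs with matching inner index, and the
  discarded terms are nonnegative.\<close>

lemma sum_mat_mult_le:
  fixes A B :: "real mat"
  assumes A: "A \<in> carrier_mat N N" "\<And>i j. i < N \<Longrightarrow> j < N \<Longrightarrow> 0 \<le> A $$ (i, j)"
    and B: "B \<in> carrier_mat N N" "\<And>i j. i < N \<Longrightarrow> j < N \<Longrightarrow> 0 \<le> B $$ (i, j)"
  shows "sum_mat (A * B) \<le> sum_mat A * sum_mat B"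
proof -
  have "sum_mat (A * B) = (\<Sum>i<N. \<Sum>j<N. \<Sum>k<N. A $$ (i, k) * B $$ (k, j))"
    unfolding sum_mat_rows[OF mult_carrier_mat[OF A(1) B(1)]]
    by (intro sum.cong refl mult_mat_entry[OF A(1) B(1)]) auto
  also have "\<dots> = (\<Sum>i<N. \<Sum>k<N. A $$ (i, k) * (\<Sum>j<N. B $$ (k, j)))"
    unfolding sum_distrib_left by (intro sum.cong refl sum.swap)
  also have "\<dots> \<le> (\<Sum>i<N. \<Sum>k<N. A $$ (i, k) * sum_mat B)"
  proof (intro sum_mono mult_left_mono)
    fix k assume "k \<in> {..<N}"
    then show "(\<Sum>j<N. B $$ (k, j)) \<le> sum_mat B"
      unfolding sum_mat_rows[OF B(1)]
      by (intro member_le_sum[of k "{..<N}" "\<lambda>k. \<Sum>j<N. B $$ (k, j)"])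
        (auto intro!: sum_nonneg B(2))
  qed (use A(2) in auto)
  also have "\<dots> = sum_mat A * sum_mat B"
    by (simp add: sum_mat_rows[OF A(1)] sum_distrib_right)
  finally show ?thesis .
qed

section \<open>Row sums of powers of a transition matrix\<close>

context
  fixes N :: nat and A :: "real mat"
  assumes A: "transition_matrix N A"
begin

lemma transition_carrier: "A \<in> carrier_mat N N" "A ^\<^sub>m n \<in> carrier_mat N N"
  using A by (auto simp: transition_matrix_def)

lemma transition_entry: "i < N \<Longrightarrow> j < N \<Longrightarrow> A $$ (i, j) = 0 \<or> A $$ (i, j) = 1"
  using A by (auto simp: transition_matrix_def)

lemma transition_pow_nonneg: "i < N \<Longrightarrow> j < N \<Longrightarrow> 0 \<le> (A ^\<^sub>m n) $$ (i, j)"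
proof (induction n arbitrary: i j)
  case 0
  then show ?case using transition_carrier(1) by simp
next
  case (Suc n)
  have "0 \<le> (A ^\<^sub>m n) $$ (i, k) * A $$ (k, j)" if "k < N" for k
    using Suc.IH[OF Suc.prems(1) that] transition_entry[OF that Suc.prems(2)] by auto
  then show ?case
    unfolding pow_mat.simps mult_mat_entry[OF transition_carrier(2,1) Suc.prems]
    by (intro sum_nonneg) simp
qed

text \<open>Row sum \<open>i\<close> of \<open>A ^\<^sub>m n\<close> counts the admissible paths of
  \<open>n\<close> steps from \<open>i\<close>. Powers are defined by multiplying on the right, so
  \<open>pow_mat_add\<close> is used to split off the first step instead of the last. The recursion
  has the shape of the induction in \<open>ex_itinerary_separated_row\<close>.\<close>

lemma transition_row_sum_Suc:
  assumes i: "i < N"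
  shows "(\<Sum>j<N. (A ^\<^sub>m Suc n) $$ (i, j))
    = (\<Sum>k\<in>{k. k < N \<and> A $$ (i, k) = 1}. \<Sum>j<N. (A ^\<^sub>m n) $$ (k, j))"
proof -
  have A1: "A ^\<^sub>m 1 = A" using transition_carrier(1) by simp
  have "A ^\<^sub>m Suc n = A * A ^\<^sub>m n"
    using pow_mat_add[OF transition_carrier(1), of 1 n] unfolding A1 by simp
  then have "(\<Sum>j<N. (A ^\<^sub>m Suc n) $$ (i, j)) = (\<Sum>j<N. \<Sum>k<N. A $$ (i, k) * (A ^\<^sub>m n) $$ (k, j))"
    using i by (simp add: mult_mat_entry[OF transition_carrier(1,2)] del: pow_mat.simps)
  also have "\<dots> = (\<Sum>k<N. A $$ (i, k) * (\<Sum>j<N. (A ^\<^sub>m n) $$ (k, j)))"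
    by (subst sum.swap) (simp add: sum_distrib_left)
  also have "\<dots> = (\<Sum>k\<in>{k. k < N \<and> A $$ (i, k) = 1}. A $$ (i, k) * (\<Sum>j<N. (A ^\<^sub>m n) $$ (k, j)))"
    by (rule sum.mono_neutral_right) (use transition_entry[OF i] in auto)
  finally show ?thesis by simp
qed

text \<open>Every row contains a 1, so every admissible path can be prolonged. This keeps the
  logarithms of the entry sums nonnegative, as \<open>fekete\<close> requires.\<close>

lemma transition_row_sum_ge_1: "i < N \<Longrightarrow> 1 \<le> (\<Sum>j<N. (A ^\<^sub>m n) $$ (i, j))"
proof (induction n arbitrary: i)
  case 0
  then show ?case using transition_carrier(1) by simp
next
  case (Suc n)
  have "\<exists>k<N. A $$ (i, k) = 1"
  proof (rule ccontr)
    assume "\<not> (\<exists>k<N. A $$ (i, k) = 1)"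
    then have "(\<Sum>k<N. A $$ (i, k)) = 0"
      using transition_entry[OF Suc.prems] by (intro sum.neutral) auto
    then show False using A Suc.prems unfolding transition_matrix_def by force
  qed
  then obtain k where k: "k < N" "A $$ (i, k) = 1" by blast
  have "1 \<le> (\<Sum>j<N. (A ^\<^sub>m n) $$ (k, j))" using Suc.IH[OF k(1)] .
  also have "\<dots> \<le> (\<Sum>k\<in>{k. k < N \<and> A $$ (i, k) = 1}. \<Sum>j<N. (A ^\<^sub>m n) $$ (k, j))"
    using k by (intro member_le_sum[of k _ "\<lambda>k. \<Sum>j<N. (A ^\<^sub>m n) $$ (k, j)"])
      (auto intro!: sum_nonneg transition_pow_nonneg)
  finally show ?case using transition_row_sum_Suc[OF Suc.prems] by simp
qed

lemma sum_mat_pow_ge_1: "1 \<le> sum_mat (A ^\<^sub>m n)"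
proof -
  have "1 \<le> N" using A by (simp add: transition_matrix_def)
  then have "1 \<le> (\<Sum>i<N. (1 :: real))" by simp
  also have "\<dots> \<le> (\<Sum>i<N. \<Sum>j<N. (A ^\<^sub>m n) $$ (i, j))"
    by (intro sum_mono transition_row_sum_ge_1) simp
  finally show ?thesis by (simp add: sum_mat_rows[OF transition_carrier(2)])
qed

text \<open>Submultiplicativity of the entry sum makes its logarithm subadditive, so Fekete's lemma
  yields a limit \<open>L\<close>. Exponentiating shows that the roots converge, so the
  \<open>lim\<close> in \<open>growth_rate\<close> is a genuine limit.\<close>

lemma ln_sum_mat_pow_tendsto: "(\<lambda>n. ln (sum_mat (A ^\<^sub>m n)) / n) \<longlonglongrightarrow> ln (growth_rate A)"
proof -
  define a where "a n = ln (sum_mat (A ^\<^sub>m n))" for n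
  have pos: "0 < sum_mat (A ^\<^sub>m n)" for n using sum_mat_pow_ge_1[of n] by simp
  have "a (m + n) \<le> a m + a n" for m n
  proof -
    have "sum_mat (A ^\<^sub>m (m + n)) \<le> sum_mat (A ^\<^sub>m m) * sum_mat (A ^\<^sub>m n)"
      unfolding pow_mat_add[OF transition_carrier(1)]
      by (rule sum_mat_mult_le) (auto intro: transition_carrier(2) transition_pow_nonneg)
    then show ?thesis using pos by (simp add: a_def flip: ln_mult_pos)
  qed
  moreover have "0 \<le> a n" for n using sum_mat_pow_ge_1[of n] by (simp add: a_def)
  ultimately obtain L where L: "(\<lambda>n. a n / n) \<longlonglongrightarrow> L" using fekete by blast
  have "(\<lambda>n. root n (sum_mat (A ^\<^sub>m n))) \<longlonglongrightarrow> exp L"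
  proof (rule Lim_transform_eventually)
    show "(\<lambda>n. exp (a n / n)) \<longlonglongrightarrow> exp L" by (intro tendsto_intros L)
    \<comment> \<open>The two sides differ at \<open>n = 0\<close>, where \<open>root 0\<close> is 0
      by convention and the exponential is 1.\<close>
    show "\<forall>\<^sub>F n in sequentially. exp (a n / n) = root n (sum_mat (A ^\<^sub>m n))"
      using eventually_gt_at_top[of 0]
      by eventually_elim (use pos in \<open>simp add: a_def root_powr_inverse powr_def less_imp_le less_imp_neq[symmetric]\<close>)
  qed
  then have "growth_rate A = exp L" unfolding growth_rate_def by (rule limI)
  then show ?thesis using L by (simp add: a_def)
qed

end

section \<open>Separated sets\<close>

text \<open>The times are \<open>0, \<dots>, n\<close>, corresponding to joins of length \<open>n + 1\<close>.\<close>

definition itinerary_separated ::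
  "(nat \<Rightarrow> 'a set) \<Rightarrow> nat \<Rightarrow> (nat \<Rightarrow> 'a \<Rightarrow> 'a) \<Rightarrow> nat \<Rightarrow> 'a set \<Rightarrow> bool" where
  "itinerary_separated W N g n P \<longleftrightarrow>
     (\<forall>x\<in>P. \<forall>y\<in>P. x \<noteq> y \<longrightarrow>
       (\<exists>k\<le>n. \<exists>a<N. \<exists>b<N. a \<noteq> b \<and> iter_seq g k x \<in> W a \<and> iter_seq g k y \<in> W b))"

text \<open>The recursion of \<open>iter_seq\<close> adds the latest map; here the earliest one is
  split off, which leaves an orbit of the system shifted by one time unit.\<close>

lemma iter_seq_Suc_shift: "iter_seq g (Suc k) x = iter_seq (\<lambda>i. g (Suc i)) k (g 0 x)"
  by (induction k) simp_all

text \<open>Points from different \<open>P i\<close>, \<open>P j\<close> are already separated at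
  time 0 by \<open>W i\<close> and \<open>W j\<close>. Disjointness of these sets also makes the
  cardinalities add up.\<close>

lemma itinerary_separated_UN:
  assumes W: "disjoint_family_on W {..<N}" and J: "J \<subseteq> {..<N}"
    and P: "\<And>j. j \<in> J \<Longrightarrow> P j \<subseteq> W j" "\<And>j. j \<in> J \<Longrightarrow> finite (P j)"
      "\<And>j. j \<in> J \<Longrightarrow> itinerary_separated W N g n (P j)"
  shows "finite (\<Union>j\<in>J. P j)" "card (\<Union>j\<in>J. P j) = (\<Sum>j\<in>J. card (P j))"
    "itinerary_separated W N g n (\<Union>j\<in>J. P j)"
proof -
  have J': "finite J" using J finite_subset by blast
  then show "finite (\<Union>j\<in>J. P j)" using P by simp
  have "W i \<inter> W j = {}" if "i \<in> J" "j \<in> J" "i \<noteq> j" for i j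
    using W J that by (meson disjoint_family_onD subsetD)
  then show "card (\<Union>j\<in>J. P j) = (\<Sum>j\<in>J. card (P j))"
    using J' P by (intro card_UN_disjoint) blast+
  show "itinerary_separated W N g n (\<Union>j\<in>J. P j)"
    unfolding itinerary_separated_def
  proof (intro ballI impI)
    fix x y assume "x \<in> (\<Union>j\<in>J. P j)" "y \<in> (\<Union>j\<in>J. P j)" and ne: "x \<noteq> y"
    then obtain i j where ij: "i \<in> J" "x \<in> P i" "j \<in> J" "y \<in> P j" by blast
    show "\<exists>k\<le>n. \<exists>a<N. \<exists>b<N. a \<noteq> b \<and> iter_seq g k x \<in> W a \<and> iter_seq g k y \<in> W b"
    proof (cases "i = j")
      case True
      then show ?thesis using P(3)[OF ij(1)] ij ne unfolding itinerary_separated_def by blast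
    next
      case False
      then have "i < N" "j < N" "i \<noteq> j" "iter_seq g 0 x \<in> W i" "iter_seq g 0 y \<in> W j"
        using ij J P(1) by auto
      then show ?thesis by blast
    qed
  qed
qed

text \<open>A time \<open>k\<close> separating two images separates their preimages at time
  \<open>k + 1\<close>.\<close>

lemma itinerary_separated_pullback:
  assumes "itinerary_separated W N (\<lambda>i. g (Suc i)) n (g 0 ` Q)" "inj_on (g 0) Q"
  shows "itinerary_separated W N g (Suc n) Q"
  unfolding itinerary_separated_def
proof (intro ballI impI)
  fix x y assume "x \<in> Q" "y \<in> Q" "x \<noteq> y"
  then have "g 0 x \<noteq> g 0 y" using assms(2) by (auto dest: inj_onD)
  then obtain k a b where k: "k \<le> n" "a < N" "b < N" "a \<noteq> b"
    "iter_seq g (Suc k) x \<in> W a" "iter_seq g (Suc k) y \<in> W b"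
    using assms(1) \<open>x \<in> Q\<close> \<open>y \<in> Q\<close> unfolding itinerary_separated_def iter_seq_Suc_shift by blast
  then show "\<exists>k\<le>Suc n. \<exists>a<N. \<exists>b<N. a \<noteq> b \<and> iter_seq g k x \<in> W a \<and> iter_seq g k y \<in> W b"
    by (meson Suc_le_mono)
qed

text \<open>The induction generalises \<open>g\<close> and \<open>V\<close>, because its hypothesis
  is applied to the system shifted by one: each successor \<open>j\<close> of \<open>i\<close>
  contributes a set in \<open>V j 1\<close>, and the union of these is pulled back through
  \<open>g 0\<close> into \<open>V i 0\<close>.\<close>

lemma ex_itinerary_separated_row:
  assumes A: "transition_matrix N A" and W: "disjoint_family_on W {..<N}"
    and "\<And>i n. i < N \<Longrightarrow> V i n \<noteq> {} \<and> V i n \<subseteq> W i"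
    and "\<And>i n. i < N \<Longrightarrow> (\<Union>j\<in>{j. j < N \<and> A $$ (i, j) = 1}. V j (Suc n)) \<subseteq> g n ` V i n"
    and "i < N"
  shows "\<exists>P\<subseteq>V i 0. finite P \<and> real (card P) = (\<Sum>j<N. (A ^\<^sub>m n) $$ (i, j)) \<and>
    itinerary_separated W N g n P"
  using assms(3-5)
proof (induction n arbitrary: g V i)
  case 0
  obtain x where "x \<in> V i 0" using 0 by blast
  moreover have "(\<Sum>j<N. (A ^\<^sub>m 0) $$ (i, j)) = 1"
    using transition_carrier(1)[OF A] 0(3) by simp
  ultimately show ?case by (intro exI[of _ "{x}"]) (simp add: itinerary_separated_def)
next
  case (Suc n)
  define J where "J = {j. j < N \<and> A $$ (i, j) = 1}"
  have "\<exists>P\<subseteq>V j (Suc 0). finite P \<and> real (card P) = (\<Sum>k<N. (A ^\<^sub>m n) $$ (j, k)) \<and>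
      itinerary_separated W N (\<lambda>i. g (Suc i)) n P" if "j \<in> J" for j
  proof (rule Suc.IH[where V = "\<lambda>i k. V i (Suc k)"])
    show "j < N" using that by (simp add: J_def)
  qed (use Suc.prems in blast)+
  then obtain P where P: "\<And>j. j \<in> J \<Longrightarrow> P j \<subseteq> V j (Suc 0)" "\<And>j. j \<in> J \<Longrightarrow> finite (P j)"
      "\<And>j. j \<in> J \<Longrightarrow> real (card (P j)) = (\<Sum>k<N. (A ^\<^sub>m n) $$ (j, k))"
      "\<And>j. j \<in> J \<Longrightarrow> itinerary_separated W N (\<lambda>i. g (Suc i)) n (P j)"
    by metis
  have J: "J \<subseteq> {..<N}" by (auto simp: J_def)
  have "P j \<subseteq> W j" if "j \<in> J" for j using P(1) Suc.prems(1) J that by blast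
  note U = itinerary_separated_UN[OF W J this P(2,4)]
  have "(\<Union>j\<in>J. P j) \<subseteq> g 0 ` V i 0"
    using P(1) Suc.prems(2)[OF Suc.prems(3), of 0] unfolding J_def by blast
  \<comment> \<open>\<open>Q\<close> contains exactly one preimage of each point of the union, so
    pulling back preserves the cardinality.\<close>
  then obtain Q where Q: "Q \<subseteq> V i 0" "inj_on (g 0) Q" "(\<Union>j\<in>J. P j) = g 0 ` Q"
    unfolding subset_image_inj by blast
  have "finite Q" using U(1) Q by (simp add: finite_image_iff)
  moreover have "real (card Q) = (\<Sum>j<N. (A ^\<^sub>m Suc n) $$ (i, j))"
  proof -
    have "card Q = (\<Sum>j\<in>J. card (P j))" using U(2) card_image[OF Q(2)] Q(3) by simp
    then show ?thesis
      using P(3) unfolding transition_row_sum_Suc[OF A Suc.prems(3)] J_def[symmetric] by simp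
  qed
  moreover have "itinerary_separated W N g (Suc n) Q"
    using itinerary_separated_pullback[of W N g n Q] U(3) Q by simp
  ultimately show ?case using Q(1) by blast
qed

lemma ex_itinerary_separated:
  assumes A: "transition_matrix N A" and W: "disjoint_family_on W {..<N}"
    and V: "\<And>i n. i < N \<Longrightarrow> V i n \<noteq> {} \<and> V i n \<subseteq> W i"
    and exp: "\<And>i n. i < N \<Longrightarrow> (\<Union>j\<in>{j. j < N \<and> A $$ (i, j) = 1}. V j (Suc n)) \<subseteq> g n ` V i n"
  obtains P where "P \<subseteq> (\<Union>i<N. V i 0)" "finite P" "real (card P) = sum_mat (A ^\<^sub>m n)"
    "itinerary_separated W N g n P"
proof -
  obtain P where P: "\<And>i. i < N \<Longrightarrow> P i \<subseteq> V i 0" "\<And>i. i < N \<Longrightarrow> finite (P i)"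
      "\<And>i. i < N \<Longrightarrow> real (card (P i)) = (\<Sum>j<N. (A ^\<^sub>m n) $$ (i, j))"
      "\<And>i. i < N \<Longrightarrow> itinerary_separated W N g n (P i)"
    using ex_itinerary_separated_row[where V = V and g = g and n = n, OF A W V exp] by metis
  have "P i \<subseteq> W i" if "i < N" for i using P(1) V that by blast
  then have U: "finite (\<Union>i<N. P i)" "card (\<Union>i<N. P i) = (\<Sum>i<N. card (P i))"
      "itinerary_separated W N g n (\<Union>i<N. P i)"
    using itinerary_separated_UN[OF W subset_refl, of P g n] P(2,4) by simp_all
  show thesis
  proof (rule that)
    show "(\<Union>i<N. P i) \<subseteq> (\<Union>i<N. V i 0)" using P(1) by fastforce
    show "real (card (\<Union>i<N. P i)) = sum_mat (A ^\<^sub>m n)"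
      using U(2) P(3) by (simp add: sum_mat_rows[OF transition_carrier(2)[OF A]])
  qed (use U in auto)
qed

section \<open>Entropy from separated sets\<close>

lemma iter_seq_in_topspace:
  assumes "\<And>k x. x \<in> topspace T \<Longrightarrow> g k x \<in> topspace T" "x \<in> topspace T"
  shows "iter_seq g k x \<in> topspace T"
  by (induction k) (use assms in auto)

text \<open>The join is indexed by functions on all of \<open>nat\<close>, but only their values
  below \<open>n\<close> matter, and there are finitely many choices for those.\<close>

lemma finite_cover_join:
  assumes "finite \<A>"
  shows "finite (cover_join T g \<A> n)"
proof -
  have "cover_join T g \<A> n \<subseteq>
      (\<lambda>U. topspace T \<inter> (\<Inter>j<n. iter_seq g j -` U j)) ` ({..<n} \<rightarrow>\<^sub>E \<A>)"
  proof
    fix C assume "C \<in> cover_join T g \<A> n"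
    then obtain U where "C = topspace T \<inter> (\<Inter>j<n. iter_seq g j -` U j)" "\<forall>j<n. U j \<in> \<A>"
      unfolding cover_join_def by blast
    then show "C \<in> (\<lambda>U. topspace T \<inter> (\<Inter>j<n. iter_seq g j -` U j)) ` ({..<n} \<rightarrow>\<^sub>E \<A>)"
      by (intro image_eqI[of _ _ "restrict U {..<n}"]) auto
  qed
  then show ?thesis
    by (rule finite_subset) (intro finite_imageI finite_PiE finite_lessThan assms)
qed

lemma Union_cover_join:
  assumes g: "\<And>k x. x \<in> topspace T \<Longrightarrow> g k x \<in> topspace T"
    and \<A>: "\<Union>\<A> = topspace T"
  shows "\<Union>(cover_join T g \<A> n) = topspace T"
proof
  show "\<Union>(cover_join T g \<A> n) \<subseteq> topspace T" by (auto simp: cover_join_def)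
  show "topspace T \<subseteq> \<Union>(cover_join T g \<A> n)"
  proof
    fix x assume x: "x \<in> topspace T"
    have "iter_seq g j x \<in> \<Union>\<A>" for j
      unfolding \<A> by (rule iter_seq_in_topspace[OF g x])
    then have "\<forall>j. \<exists>U\<in>\<A>. iter_seq g j x \<in> U" by blast
    then obtain U where U: "\<And>j. U j \<in> \<A>" "\<And>j. iter_seq g j x \<in> U j" by metis
    then have "topspace T \<inter> (\<Inter>j<n. iter_seq g j -` U j) \<in> cover_join T g \<A> n"
      unfolding cover_join_def by blast
    then show "x \<in> \<Union>(cover_join T g \<A> n)" using x U(2) by blast
  qed
qed

text \<open>Two points in one member of the join share an element of \<open>\<A>\<close> at every
  time below \<open>n\<close>. Hence assigning to each point of \<open>S\<close> a member of a
  minimal subcover containing it is injective.\<close>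

lemma card_le_min_subcover_card:
  assumes g: "\<And>k x. x \<in> topspace T \<Longrightarrow> g k x \<in> topspace T"
    and \<A>: "finite \<A>" "\<Union>\<A> = topspace T"
    and S: "S \<subseteq> topspace T"
    and sep: "\<And>x y. x \<in> S \<Longrightarrow> y \<in> S \<Longrightarrow> x \<noteq> y \<Longrightarrow>
      \<exists>k<n. \<forall>U\<in>\<A>. \<not> (iter_seq g k x \<in> U \<and> iter_seq g k y \<in> U)"
  shows "card S \<le> min_subcover_card T (cover_join T g \<A> n)"
proof -
  define \<C> where "\<C> = cover_join T g \<A> n"
  have "finite \<C>" unfolding \<C>_def by (rule finite_cover_join[OF \<A>(1)])
  moreover have "\<Union>\<C> = topspace T" unfolding \<C>_def by (rule Union_cover_join[OF g \<A>(2)])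
  \<comment> \<open>The finite join is a subcover of itself, so the \<open>LEAST\<close> in
    \<open>min_subcover_card\<close> is attained.\<close>
  ultimately have "\<exists>k. \<exists>\<D>\<subseteq>\<C>. finite \<D> \<and> \<Union>\<D> = topspace T \<and> card \<D> = k" by blast
  then have "\<exists>\<D>\<subseteq>\<C>. finite \<D> \<and> \<Union>\<D> = topspace T \<and> card \<D> = min_subcover_card T \<C>"
    unfolding min_subcover_card_def by (rule LeastI_ex)
  then obtain \<D> where \<D>: "\<D> \<subseteq> \<C>" "finite \<D>" "\<Union>\<D> = topspace T"
      "card \<D> = min_subcover_card T \<C>" by blast
  have "\<forall>x\<in>S. \<exists>C. C \<in> \<D> \<and> x \<in> C" using S \<D>(3) by blast
  then obtain h where h: "\<And>x. x \<in> S \<Longrightarrow> h x \<in> \<D> \<and> x \<in> h x" by metis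
  have "inj_on h S"
  proof (rule inj_onI, rule ccontr)
    fix x y assume xy: "x \<in> S" "y \<in> S" "h x = h y" "x \<noteq> y"
    then obtain k where k: "k < n" "\<forall>U\<in>\<A>. \<not> (iter_seq g k x \<in> U \<and> iter_seq g k y \<in> U)"
      using sep[OF xy(1,2,4)] by blast
    have "h x \<in> cover_join T g \<A> n" using h xy(1) \<D>(1) \<C>_def by blast
    then obtain U where U: "\<forall>j<n. U j \<in> \<A>" "h x = topspace T \<inter> (\<Inter>j<n. iter_seq g j -` U j)"
      unfolding cover_join_def by blast
    have "x \<in> h x" "y \<in> h x" using h xy by auto
    then show False using U k by blast
  qed
  then have "card S \<le> card \<D>" by (rule card_inj_on_le) (use h \<D>(2) in auto)
  then show ?thesis using \<D>(4) \<C>_def by simp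
qed

text \<open>A constant factor \<open>c\<close> costs only \<open>ln c / n\<close>, which vanishes in
  the limit. It leaves room for a shift between the exponent of \<open>A\<close> and the length of
  the join.\<close>

lemma topological_entropy_ge:
  assumes "open_cover T \<A>"
    and lim: "(\<lambda>n. ln (s n) / n) \<longlonglongrightarrow> L"
    and pos: "\<And>n. 0 < s n"
    and le: "\<And>n. 0 < n \<Longrightarrow> s n \<le> c * real (min_subcover_card T (cover_join T g \<A> n))"
    and c: "0 < c"
  shows "ereal L \<le> topological_entropy T g"
proof -
  define m where "m n = real (min_subcover_card T (cover_join T g \<A> n))" for n
  have "(\<lambda>n. ln (s n) / n - ln c / n) \<longlonglongrightarrow> L - 0"
    by (intro tendsto_diff lim lim_const_over_n)
  then have "ereal L = limsup (\<lambda>n. ereal (ln (s n) / n - ln c / n))"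
    by (intro lim_imp_Limsup[symmetric]) auto
  also have "\<dots> \<le> limsup (\<lambda>n. ereal (ln (m n) / n))"
  proof (rule Limsup_mono, rule eventually_mono[OF eventually_gt_at_top[of 0]])
    fix n :: nat assume n: "0 < n"
    have "0 < c * m n" using pos[of n] le[OF n] by (simp add: m_def)
    then have "0 < m n" using c by (simp add: zero_less_mult_iff)
    then have "ln (s n) \<le> ln c + ln (m n)"
      using pos[of n] le[OF n] c by (simp add: m_def flip: ln_mult_pos)
    then have "(ln (s n) - ln c) / n \<le> ln (m n) / n" by (intro divide_right_mono) auto
    then show "ereal (ln (s n) / n - ln c / n) \<le> ereal (ln (m n) / n)"
      by (simp add: diff_divide_distrib)
  qed
  also have "\<dots> \<le> topological_entropy T g"
    unfolding topological_entropy_def m_def using assms(1) by (intro SUP_upper) simp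
  finally show ?thesis .
qed

section \<open>The hyperspace\<close>

lemma singleton_in_nonempty_compacts: "x \<in> mspace X \<Longrightarrow> {x} \<in> nonempty_compacts X"
  by (simp add: nonempty_compacts_def)

lemma image_in_nonempty_compacts:
  assumes "continuous_map (mtopology_of X) (mtopology_of X) f" "B \<in> nonempty_compacts X"
  shows "f ` B \<in> nonempty_compacts X"
  using assms image_compactin by (auto simp: nonempty_compacts_def)

text \<open>Singletons carry the orbits of \<open>f\<close> into the hyperspace, so separated points
  of \<open>X\<close> give separated points there.\<close>

lemma iter_seq_image_singleton: "iter_seq (\<lambda>n B. f n ` B) k {x} = {iter_seq f k x}"
  by (induction k) simp_all

text \<open>If \<open>b \<in> B\<close> has a ball of radius \<open>r\<close> missing
  \<open>F\<close>, then every \<open>C\<close> at Hausdorff distance less than \<open>r\<close>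
  from \<open>B\<close> has a point in that ball.\<close>

lemma openin_hyperspace_not_subset:
  assumes F: "closedin (mtopology_of X) F"
  shows "openin (mtopology_of (hyperspace X)) {B \<in> nonempty_compacts X. \<not> B \<subseteq> F}"
proof -
  interpret M: Metric_space "mspace X" "mdist X" by (rule Metric_space_mspace_mdist)
  interpret H: Metric_space "nonempty_compacts X" "mdist (hyperspace X)"
    using Metric_space_mspace_mdist[of "hyperspace X"] by simp
  have "\<exists>r>0. H.mball B r \<subseteq> {B \<in> nonempty_compacts X. \<not> B \<subseteq> F}"
    if B: "B \<in> nonempty_compacts X" "\<not> B \<subseteq> F" for B
  proof -
    obtain b where b: "b \<in> B" "b \<notin> F" using B by blast
    have "openin M.mtopology (mspace X - F)"
      using F by (simp add: closedin_def mtopology_of_def)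
    moreover have bX: "b \<in> mspace X" using b nonempty_compactsD(2)[OF B(1)] by blast
    ultimately obtain r where r: "r > 0" "M.mball b r \<subseteq> mspace X - F"
      using b unfolding M.openin_mtopology by blast
    have "\<not> C \<subseteq> F" if C: "C \<in> H.mball B r" for C
    proof -
      have CK: "C \<in> nonempty_compacts X" and "hausdorff_mdist X B C < r"
        using C B(1) by (auto simp: mdist_hyperspace)
      then have "mdist_set X b C < r"
        using mdist_set_le_hausdorff[OF B(1) CK b(1)] by simp
      then have "\<exists>c\<in>C. mdist X b c < r"
        unfolding mdist_set_def using nonempty_compactsD(1)[OF CK]
        by (subst (asm) cINF_less_iff) (auto intro!: bdd_belowI2[where m = 0])
      then obtain c where c: "c \<in> C" "mdist X b c < r" by blast
      then have "c \<in> M.mball b r" using bX nonempty_compactsD(2)[OF CK] by auto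
      then show ?thesis using r(2) c(1) by blast
    qed
    then show ?thesis using r(1) by (intro exI[of _ r]) auto
  qed
  then show ?thesis
    unfolding mtopology_of_def mspace_hyperspace H.openin_mtopology by blast
qed

theorem theorem4p9:
  fixes X :: "'a metric" and f :: "nat \<Rightarrow> 'a \<Rightarrow> 'a"
    and N :: nat and A :: "real mat"
    and W :: "nat \<Rightarrow> 'a set" and V :: "nat \<Rightarrow> nat \<Rightarrow> 'a set"
  assumes "compact_space (mtopology_of X)"
    and "\<And>n. continuous_map (mtopology_of X) (mtopology_of X) (f n)"
    and "transition_matrix N A"
    and "\<And>i. i < N \<Longrightarrow> W i \<noteq> {} \<and> closedin (mtopology_of X) (W i)"
    and "disjoint_family_on W {..<N}"
    and "\<And>i n. i < N \<Longrightarrow> V i n \<noteq> {} \<and> compactin (mtopology_of X) (V i n) \<and> V i n \<subseteq> W i"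
    and "weakly_coupled_expanding (mtopology_of X) N A f V"
  shows "topological_entropy (mtopology_of (hyperspace X)) (\<lambda>n B. f n ` B)
           \<ge> ereal (ln (growth_rate A))"
proof -
  note cont = assms(2) and A = assms(3) and W = assms(5)
  define T where "T = mtopology_of (hyperspace X)"
  define g where "g = (\<lambda>n B. f n ` B)"
  define F where "F i = (\<Union>j\<in>{..<N} - {i}. W j)" for i
  define G where "G i = {B \<in> nonempty_compacts X. \<not> B \<subseteq> F i}" for i
  have N: "0 < N" "1 < N" using A by (auto simp: transition_matrix_def)
  have T: "topspace T = nonempty_compacts X" by (simp add: T_def)
  have g: "g k B \<in> topspace T" if "B \<in> topspace T" for k B
    using that image_in_nonempty_compacts[OF cont] by (simp add: T g_def)
  have sep: "i = j" if "x \<in> W i" "x \<in> W j" "i < N" "j < N" for x i j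
    using disjoint_family_onD[OF W, of i j] that by auto
  have "closedin (mtopology_of X) (F i)" for i
    unfolding F_def by (rule closedin_Union) (use assms(4) in auto)
  then have openG: "openin T (G i)" for i
    unfolding T_def G_def by (rule openin_hyperspace_not_subset)
  have cover: "\<Union>(G ` {..<N}) = topspace T"
  proof
    show "\<Union>(G ` {..<N}) \<subseteq> topspace T" by (auto simp: G_def T)
    show "topspace T \<subseteq> \<Union>(G ` {..<N})"
    proof
      fix B assume "B \<in> topspace T"
      then have B: "B \<in> nonempty_compacts X" by (simp add: T)
      then obtain b where b: "b \<in> B" using nonempty_compactsD(1) by blast
      \<comment> \<open>If \<open>b\<close> lies in \<open>W i\<close>, disjointness keeps it out of
        \<open>F i\<close>; if it lies in no \<open>W i\<close>, any index will do, and one exists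
        as \<open>0 < N\<close>.\<close>
      have "\<exists>i<N. b \<notin> F i"
      proof (cases "\<exists>i<N. b \<in> W i")
        case True
        then show ?thesis using sep unfolding F_def by blast
      next
        case False
        then show ?thesis using N unfolding F_def by blast
      qed
      then show "B \<in> \<Union>(G ` {..<N})" using B b by (auto simp: G_def)
    qed
  qed
  \<comment> \<open>Separation at the times \<open>0\<close> to \<open>n\<close> uses
    \<open>n + 1\<close> factors of the join.\<close>
  have le: "sum_mat (A ^\<^sub>m n) \<le> real (min_subcover_card T (cover_join T g (G ` {..<N}) (Suc n)))" for n
  proof -
    have VW: "V i n \<noteq> {} \<and> V i n \<subseteq> W i" if "i < N" for i n using assms(6) that by blast
    have exp: "(\<Union>j\<in>{j. j < N \<and> A $$ (i, j) = 1}. V j (Suc n)) \<subseteq> f n ` V i n" if "i < N" for i n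
      using assms(7) that unfolding weakly_coupled_expanding_def by blast
    obtain P where P: "P \<subseteq> (\<Union>i<N. V i 0)" "real (card P) = sum_mat (A ^\<^sub>m n)"
        "itinerary_separated W N f n P"
      using ex_itinerary_separated[where V = V and g = f and n = n, OF A W VW exp] by metis
    have "V i 0 \<subseteq> mspace X" if "i < N" for i
      using assms(6)[OF that, of 0] compactin_subset_topspace[of "mtopology_of X"] by simp
    then have PX: "P \<subseteq> mspace X" using P(1) by blast
    have "card ((\<lambda>x. {x}) ` P) \<le> min_subcover_card T (cover_join T g (G ` {..<N}) (Suc n))"
    proof (rule card_le_min_subcover_card[OF g _ cover])
      show "finite (G ` {..<N})" by (intro finite_imageI finite_lessThan)
      show "(\<lambda>x. {x}) ` P \<subseteq> topspace T"
        unfolding T by (intro image_subsetI singleton_in_nonempty_compacts subsetD[OF PX])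
      fix B C assume "B \<in> (\<lambda>x. {x}) ` P" "C \<in> (\<lambda>x. {x}) ` P" "B \<noteq> C"
      then obtain x y where xy: "x \<in> P" "y \<in> P" "x \<noteq> y" "B = {x}" "C = {y}" by blast
      then obtain k a b where k: "k \<le> n" "a < N" "b < N" "a \<noteq> b"
          "iter_seq f k x \<in> W a" "iter_seq f k y \<in> W b"
        using P(3) unfolding itinerary_separated_def by metis
      \<comment> \<open>A set \<open>G i\<close> containing both singletons at time \<open>k\<close>
        would force \<open>i = a\<close> and \<open>i = b\<close>.\<close>
      have only: "i = j" if "i < N" "j < N" "z \<in> W j" "{z} \<in> G i" for i j z
        using that unfolding G_def F_def by blast
      have "\<not> (iter_seq g k B \<in> U \<and> iter_seq g k C \<in> U)" if U: "U \<in> G ` {..<N}" for U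
      proof -
        obtain i where i: "i < N" "U = G i" using U by blast
        show ?thesis
          using only[OF i(1) k(2,5)] only[OF i(1) k(3,6)] k(4)
          unfolding xy g_def iter_seq_image_singleton i(2) by blast
      qed
      then show "\<exists>k<Suc n. \<forall>U\<in>G ` {..<N}. \<not> (iter_seq g k B \<in> U \<and> iter_seq g k C \<in> U)"
        using k(1) by (intro exI[of _ k]) auto
    qed
    then show ?thesis using P(2) by (simp add: card_image inj_on_def)
  qed
  have c: "0 < sum_mat A"
    using sum_mat_pow_ge_1[OF A, of 1] transition_carrier(1)[OF A] by simp
  have "ereal (ln (growth_rate A)) \<le> topological_entropy T g"
  proof (rule topological_entropy_ge)
    show "open_cover T (G ` {..<N})" using openG cover by (auto simp: open_cover_def)
    show "(\<lambda>n. ln (sum_mat (A ^\<^sub>m n)) / n) \<longlonglongrightarrow> ln (growth_rate A)"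
      by (rule ln_sum_mat_pow_tendsto[OF A])
    \<comment> \<open>The bound \<open>le\<close> relates exponent \<open>m\<close> to length
      \<open>m + 1\<close>. One use of submultiplicativity raises the exponent to
      \<open>m + 1\<close> at the cost of the constant factor \<open>sum_mat A\<close>.\<close>
    show "sum_mat (A ^\<^sub>m n) \<le> sum_mat A * real (min_subcover_card T (cover_join T g (G ` {..<N}) n))"
      if n: "0 < n" for n
    proof -
      obtain m where m: "n = Suc m" using n by (cases n) auto
      have "sum_mat (A ^\<^sub>m n) \<le> sum_mat (A ^\<^sub>m m) * sum_mat A"
        unfolding m pow_mat.simps
      proof (rule sum_mat_mult_le[of _ N])
        show "0 \<le> A $$ (i, j)" if "i < N" "j < N" for i j
          using transition_entry[OF A that] by auto
      qed (rule transition_carrier[OF A] transition_pow_nonneg[OF A] | assumption)+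
      also have "\<dots> \<le> real (min_subcover_card T (cover_join T g (G ` {..<N}) n)) * sum_mat A"
        unfolding m by (intro mult_right_mono le) (use c in simp)
      finally show ?thesis by (simp add: mult.commute)
    qed
    show "0 < sum_mat A" by (rule c)
    show "0 < sum_mat (A ^\<^sub>m n)" for n using sum_mat_pow_ge_1[OF A, of n] by simp
  qed
  then show ?thesis by (simp add: T_def g_def)
qed

end
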